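(* Let $n$ be a positive integer with $4\mid n$, $\frac{n}{4}$ odd and $\gcd(n,5)=1$. Let $S=\{x\in\mathbb{F}_{2^n}: x^{-4}=x^{-1}+1\}$. Then the function $f(x)=x^{-1}+\delta_S(x)$ is a differentially 4-uniform permutation over $\mathbb{F}_{2^n}$.
   Context: The convention $0^{-1}=0$ is used, so $x^{-1}=x^{2^n-2}$ on $\mathbb{F}_{2^n}$, and $x^{-4}=(x^{-1})^4$. For $S\subseteq\mathbb{F}_{2^n}$, $\delta_S:\mathbb{F}_{2^n}\to\mathbb{F}_2\subseteq\mathbb{F}_{2^n}$ is the characteristic function: $\delta_S(x)=1$ if $x\in S$ and $\delta_S(x)=0$ otherwise. For $f:\mathbb{F}_{2^n}\to\mathbb{F}_{2^n}$, the differential uniformity is $\Delta_f=\max\{N(a,b): a,b\in\mathbb{F}_{2^n}, a\neq 0\}$, where $N(a,b)$ is the number of $x\in\mathbb{F}_{2^n}$ with $f(x+a)+f(x)=b$. $f$ is differentially 4-uniform if $\Delta_f=4$. *)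

theory Defs
  imports Complex_Main "HOL-Library.Indicator_Function" "HOL-Library.Cardinality"
begin

definition differential_count :: "('a::{finite,field} \<Rightarrow> 'a) \<Rightarrow> 'a \<Rightarrow> 'a \<Rightarrow> nat" where
  "differential_count f a b = card {x. f (x + a) + f x = b}"

text \<open>
  The derivative in direction \<open>a\<close> is written with \<open>+\<close>, so these notions are the usual ones only
  in characteristic 2.
\<close>

definition differential_uniformity :: "('a::{finite,field} \<Rightarrow> 'a) \<Rightarrow> nat" where
  "differential_uniformity f = Max {differential_count f a b | a b. a \<noteq> 0}"

definition differentially_4_uniform :: "('a::{finite,field} \<Rightarrow> 'a) \<Rightarrow> bool" where
  "differentially_4_uniform f \<longleftrightarrow> differential_uniformity f = 4"

end

theory Submission
  imports Defs "HOL-Computational_Algebra.Polynomial"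
begin

text \<open>
  Write \<open>f x = \<tau> (inverse x)\<close>, where \<open>\<tau>\<close> adds 1 on the roots of \<open>y\<^sup>4 = y + 1\<close>; this set is stable
  under adding 1, so \<open>\<tau>\<close> is an involution. The solutions of \<open>f (x + a) + f x = b\<close> satisfy
  \<open>inverse (x + a) + inverse x = b\<close> or \<open>= b + 1\<close>. Each of these has at most two solutions,
  except that for the right-hand side \<open>inverse a\<close> the solutions form the two pairs \<open>{0, a}\<close> and
  \<open>{a\<omega>, a\<omega>\<^sup>2}\<close> with \<open>\<omega>\<close> a primitive cube root of unity. If \<open>b = inverse a\<close>, the equation with
  \<open>b + 1\<close> contributes nothing: a solution \<open>x \<in> S\<close> would make \<open>t = a / x\<close> satisfy \<open>t\<^sup>2 + t = \<zeta>\<close> with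
  \<open>\<zeta>\<close> a primitive fifth root of unity, hence \<open>t ^ 16 = t + 1\<close>, which is impossible as \<open>n / 4\<close> is
  odd. If \<open>b + 1 = inverse a\<close>, only one of the two pairs meets the condition on \<open>S\<close>.
\<close>

section \<open>Finite field facts obtained by counting\<close>

lemma two_eq_zero_if_card_power_two:
  assumes "CARD('a::{finite,field}) = 2 ^ n"
  shows "(2::'a) = 0"
proof -
  \<comment> \<open>Translation by 1 permutes the field, so the added ones must sum to zero.\<close>
  have "(\<Sum>y\<in>UNIV. y + 1) = \<Sum>(UNIV::'a set)"
    by (rule sum.reindex_bij_witness[where i = "\<lambda>y. y - 1" and j = "\<lambda>y. y + 1"]) auto
  then have "of_nat CARD('a) = (0::'a)"
    by (simp add: sum.distrib)
  then show ?thesis by (simp add: assms)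
qed

lemma power_card_minus_one_eq_one:
  fixes x :: "'a::{finite,field}"
  assumes "x \<noteq> 0"
  shows "x ^ (CARD('a) - 1) = 1"
proof -
  \<comment> \<open>Multiplication by \<open>x\<close> permutes the nonzero elements, whose nonzero
    product can then be cancelled.\<close>
  have "(\<Prod>y\<in>UNIV - {0}. x * y) = \<Prod>(UNIV - {0::'a})"
    by (rule prod.reindex_bij_witness[where i = "\<lambda>y. y / x" and j = "\<lambda>y. x * y"])
      (use assms in auto)
  then show ?thesis
    by (simp add: prod.distrib card_Diff_subset)
qed

lemma power_card_eq_self:
  fixes x :: "'a::{finite,field}"
  shows "x ^ CARD('a) = x"
proof (cases "x = 0")
  case False
  have "x ^ CARD('a) = x * x ^ (CARD('a) - 1)"
    by (simp add: power_eq_if)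
  with power_card_minus_one_eq_one[OF False] show ?thesis by simp
qed simp

lemma three_dvd_four_power_minus_one: "3 dvd (4::nat) ^ k - 1"
proof (induction k)
  case (Suc k)
  have "(4::nat) ^ Suc k - 1 = 3 * 4 ^ k + (4 ^ k - 1)" by simp
  with Suc show ?case by (metis dvd_add dvd_triv_left)
qed simp

text \<open>
  Without \<open>\<omega>\<close>, cubing would be bijective, and the nonzero elements would all be roots of
  \<open>X ^ ((q - 1) / 3) - 1\<close>.
\<close>

lemma ex_primitive_cube_root:
  assumes card: "CARD('a::{finite,field}) = 4 ^ k" and "k > 0"
  shows "\<exists>w::'a. w\<^sup>2 + w + 1 = 0"
proof (rule ccontr)
  assume none: "\<nexists>w::'a. w\<^sup>2 + w + 1 = 0"
  have inj: "inj (\<lambda>x::'a. x ^ 3)"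
  proof (rule injI, rule ccontr)
    fix x y :: 'a
    assume eq: "x ^ 3 = y ^ 3" and "x \<noteq> y"
    then have "y \<noteq> 0" by auto
    have "(x - y) * (x\<^sup>2 + x * y + y\<^sup>2) = 0"
      using eq by algebra
    with \<open>x \<noteq> y\<close> have "x\<^sup>2 + x * y + y\<^sup>2 = 0" by simp
    with \<open>y \<noteq> 0\<close> have "(x / y)\<^sup>2 + x / y + 1 = 0"
      by (simp add: field_simps power2_eq_square)
    with none show False by blast
  qed
  obtain d where d: "CARD('a) - 1 = 3 * d"
    using three_dvd_four_power_minus_one[of k] card by auto
  have "(4::nat) ^ 1 \<le> 4 ^ k"
    using \<open>k > 0\<close> by (intro power_increasing) auto
  with d card have "d > 0" by (cases d) auto
  have root: "x ^ d = 1" if "x \<noteq> 0" for x :: 'a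
  proof -
    obtain u where u: "x = u ^ 3"
      using finite_UNIV_inj_surj[OF finite_class.finite_UNIV inj] by (auto elim: surjE)
    with that have "u \<noteq> 0" by auto
    from power_card_minus_one_eq_one[OF this] show ?thesis
      by (simp only: u d power_mult)
  qed
  let ?p = "monom 1 d - 1 :: 'a poly"
  have "degree ?p \<le> d"
    by (intro degree_diff_le) (auto simp: degree_monom_eq)
  moreover have "?p \<noteq> 0"
    using \<open>d > 0\<close> by (metis degree_1 degree_monom_eq eq_iff_diff_eq_0 less_not_refl one_neq_zero)
  moreover have "card (UNIV - {0::'a}) \<le> card {x. poly ?p x = 0}"
    by (rule card_mono) (auto simp: poly_monom root)
  ultimately have "CARD('a) - 1 \<le> d"
    using card_poly_roots_bound[of ?p] by (simp add: card_Diff_subset)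
  with d \<open>d > 0\<close> show False by simp
qed

section \<open>Arithmetic in characteristic 2\<close>

context
  assumes char_two: "(2::'a::{finite,field}) = 0"
begin

lemma char_two_add_self: "x + x = (0::'a)"
  using char_two by (metis mult_2 mult_zero_left)

lemma char_two_minus: "- x = (x::'a)"
  using char_two_add_self by (metis minus_unique)

lemma char_two_add_add: "x + y + y = (x::'a)"
  by (simp add: add.assoc char_two_add_self)

lemma char_two_square_add: "(x + y)\<^sup>2 = x\<^sup>2 + (y::'a)\<^sup>2"
  by (simp add: power2_sum char_two)

lemma char_two_fourth_power_add: "(x + y) ^ 4 = x ^ 4 + (y::'a) ^ 4"
  using char_two_square_add[of x y] char_two_square_add[of "x\<^sup>2" "y\<^sup>2"]
  by (metis numeral_Bit0 power_add power2_eq_square)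

lemma quadratic_other_root:
  fixes x y p :: 'a
  assumes "x * (x + p) = y * (y + p)"
  shows "y = x \<or> y = x + p"
proof -
  \<comment> \<open>This consequence of the assumption is valid in every characteristic; the
    explicit multiple of 2 then vanishes. Later polynomial identities use the same device.\<close>
  have "(y + x) * (y + (x + p)) = 2 * (x * y + x * (x + p))"
    using assms by algebra
  then have "(y + x) * (y + (x + p)) = 0"
    by (simp add: char_two)
  then show ?thesis
    by (metis add_eq_0_iff char_two_minus mult_eq_0_iff)
qed

lemma card_le_two_if_quadratic:
  fixes X :: "'a set"
  assumes "\<And>x. x \<in> X \<Longrightarrow> x * (x + p) = q"
  shows "card X \<le> 2"
proof (cases "X = {}")
  case False
  then obtain x where "x \<in> X" by blast
  have "X \<subseteq> {x, x + p}"
    using quadratic_other_root assms \<open>x \<in> X\<close> by (metis insert_iff subsetI)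
  then have "card X \<le> card {x, x + p}"
    by (intro card_mono) auto
  also have "\<dots> \<le> 2" by (simp add: card_insert_if)
  finally show ?thesis .
qed simp

section \<open>The derivative of inversion\<close>

lemma inverse_derivative_eq:
  fixes x a c :: 'a
  assumes "inverse (x + a) + inverse x = c" "x \<noteq> 0" "x \<noteq> a"
  shows "c * (x * (x + a)) = a"
proof -
  have "x + a \<noteq> 0"
    using assms(3) by (metis add_eq_0_iff char_two_minus)
  then have "inverse (x + a) * (x * (x + a)) = x" "inverse x * (x * (x + a)) = x + a"
    using assms(2) by (simp_all add: divide_simps)
  then have "(inverse (x + a) + inverse x) * (x * (x + a)) = x + (x + a)"
    by (simp only: distrib_right)
  then have "c * (x * (x + a)) = x + (x + a)"
    by (simp only: assms(1))
  then show ?thesis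
    by (simp add: add.assoc[symmetric] char_two_add_self)
qed

text \<open>By the convention \<open>inverse 0 = 0\<close>, one of the two summands vanishes at each
  of these points.\<close>

lemma inverse_derivative_ends:
  fixes x a c :: 'a
  assumes "inverse (x + a) + inverse x = c" "x = 0 \<or> x = a"
  shows "c = inverse a"
  using assms by (auto simp: char_two_add_self)

text \<open>The points 0 and \<open>a\<close> are excluded, so clearing denominators puts all
  solutions on one quadratic.\<close>

lemma card_inverse_derivative_le_two:
  fixes a c :: 'a
  assumes "a \<noteq> 0" "c \<noteq> inverse a"
  shows "card {x. inverse (x + a) + inverse x = c} \<le> 2"
proof (rule card_le_two_if_quadratic)
  fix x assume "x \<in> {x. inverse (x + a) + inverse x = c}"
  then have eq: "inverse (x + a) + inverse x = c" by simp
  from inverse_derivative_eq[OF eq] inverse_derivative_ends[OF eq] assms(2)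
  have "c * (x * (x + a)) = a" by blast
  moreover from this have "c \<noteq> 0" using assms(1) by auto
  ultimately show "x * (x + a) = a / c"
    by (metis nonzero_mult_div_cancel_left)
qed

text \<open>The quadratic x(x + a) = a^2 describes the pair of multiples of \<open>a\<close> by
  primitive cube roots of unity without naming such a root.\<close>

lemma inverse_derivative_eq_inverse:
  fixes x a :: 'a
  assumes "inverse (x + a) + inverse x = inverse a" "a \<noteq> 0"
  shows "x = 0 \<or> x = a \<or> x * (x + a) = a\<^sup>2"
proof -
  have "x * (x + a) = a * (inverse a * (x * (x + a)))"
    using assms(2) by simp
  then show ?thesis
    using inverse_derivative_eq[OF assms(1)] by (metis power2_eq_square)
qed

lemma inverse_derivative_eq_inverseI:
  fixes x a :: 'a
  assumes "x * (x + a) = a\<^sup>2" "a \<noteq> 0"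
  shows "inverse (x + a) + inverse x = inverse a"
proof -
  have nz: "x \<noteq> 0" "x + a \<noteq> 0" using assms by auto
  then have "inverse (x + a) + inverse x = (x + (x + a)) / (x * (x + a))"
    by (simp add: field_simps)
  also have "\<dots> = a / a\<^sup>2"
    by (simp add: assms(1) add.assoc[symmetric] char_two_add_self)
  finally show ?thesis using assms(2) by (simp add: field_simps power2_eq_square)
qed

section \<open>Fifth roots of unity and an Artin-Schreier equation\<close>

lemma fifth_root_not_artin_schreier:
  fixes t z :: 'a
  assumes card: "CARD('a) = 16 ^ m" and "odd m"
    and z: "z ^ 4 + z ^ 3 + z\<^sup>2 + z + 1 = 0"
  shows "t\<^sup>2 + t \<noteq> z"
proof
  assume t: "t\<^sup>2 + t = z"
  have t2: "t\<^sup>2 = t + z"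
    using t char_two_add_add by (metis add.commute)
  have "t ^ 4 = (t\<^sup>2)\<^sup>2"
    by (simp flip: power_mult)
  also have "\<dots> = t\<^sup>2 + z\<^sup>2"
    unfolding t2 char_two_square_add ..
  finally have t4: "t ^ 4 = t + z + z\<^sup>2"
    by (simp add: t2)
  have "t ^ 16 = (t ^ 4) ^ 4"
    by (simp flip: power_mult)
  also have "\<dots> = t ^ 4 + z ^ 4 + (z\<^sup>2) ^ 4"
    unfolding t4 char_two_fourth_power_add ..
  \<comment> \<open>The assumption \<open>z\<close> gives z^5 = 1, so z^8 = z^3, and z + z^2 + z^3 +
    z^4 = -1.\<close>
  also have "\<dots> = t + 1 - 2"
    unfolding t4 using z by algebra
  also have "\<dots> = t + 1"
    by (simp only: char_two diff_zero)
  finally have t16: "t ^ 16 = t + 1" .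
  \<comment> \<open>Each 16th power adds 1. After \<open>m\<close> of them the Frobenius map has
    come back to the identity, although an odd number of ones has been added.\<close>
  have "t ^ 16 ^ k = t + of_nat k" for k
  proof (induction k)
    case (Suc k)
    have "t ^ 16 ^ Suc k = (t ^ 16 ^ k) ^ 16"
      by (simp flip: power_mult add: mult.commute)
    also have "\<dots> = ((t + of_nat k) ^ 4) ^ 4"
      by (simp flip: power_mult add: Suc)
    also have "\<dots> = t ^ 16 + of_nat k ^ 16"
      by (simp flip: power_mult add: char_two_fourth_power_add)
    \<comment> \<open>In characteristic 2 the image of \<open>k\<close> is 0 or 1.\<close>
    also have "of_nat k ^ 16 = (of_nat k :: 'a)"
      using char_two by (cases "even k") (auto elim!: evenE oddE)
    finally show ?case by (simp add: t16 algebra_simps)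
  qed simp
  from this[of m] have "t = t + of_nat m"
    using power_card_eq_self[of t] card by simp
  moreover have "of_nat m = (1::'a)"
    using \<open>odd m\<close> char_two by (auto elim!: oddE)
  ultimately show False by simp
qed

text \<open>Multiply by x^4; at x = 0 both sides are false.\<close>

lemma inverse_quartic_iff:
  fixes x :: 'a
  shows "inverse x ^ 4 = inverse x + 1 \<longleftrightarrow> x ^ 4 + x ^ 3 = 1"
proof (cases "x = 0")
  case False
  have "inverse x ^ 4 = inverse x + 1 \<longleftrightarrow> x ^ 4 * inverse x ^ 4 = x ^ 4 * (inverse x + 1)"
    using False by simp
  also have "x ^ 4 * inverse x ^ 4 = 1"
    using False by (simp flip: power_mult_distrib)
  also have "x ^ 4 * (inverse x + 1) = x ^ 4 + x ^ 3"
    using False by (simp add: field_simps eval_nat_numeral)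
  finally show ?thesis by metis
qed simp

lemma inverse_derivative_neq_inverse_plus_one:
  fixes x a :: 'a
  assumes card: "CARD('a) = 16 ^ m" "odd m" and "a \<noteq> 0"
    and x: "x ^ 4 + x ^ 3 = 1"
  shows "inverse (x + a) + inverse x \<noteq> inverse a + 1"
proof
  assume eq: "inverse (x + a) + inverse x = inverse a + 1"
  have x0: "x \<noteq> 0" using x by auto
  have x1: "x + 1 \<noteq> 0"
  proof
    assume "x + 1 = 0"
    then have "x = 1" by (metis add_eq_0_iff char_two_minus)
    with x char_two show False by simp
  qed
  have "(inverse a + 1) * (x * (x + a)) = a"
    using inverse_derivative_eq[OF eq] inverse_derivative_ends[OF eq] x0
    by (metis add_cancel_right_right one_neq_zero)
  moreover have "1 + a = a * (inverse a + 1)"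
    using \<open>a \<noteq> 0\<close> by (simp add: distrib_left)
  ultimately have quad: "(1 + a) * (x * (x + a)) = a\<^sup>2"
    by (simp only: mult.assoc power2_eq_square)
  define t where "t = a / x"
  have a: "a = t * x" using x0 by (simp add: t_def)
  \<comment> \<open>Substituting a = t x makes \<open>quad\<close> divisible by x^2 and leaves (t^2
    + t)(x + 1) = 1.\<close>
  have "x\<^sup>2 * ((t\<^sup>2 + t) * (x + 1)) = x\<^sup>2 * 1 + 2 * (x\<^sup>2 * (t\<^sup>2 - 1))"
    using quad unfolding a by algebra
  then have "x\<^sup>2 * ((t\<^sup>2 + t) * (x + 1)) = x\<^sup>2 * 1"
    unfolding char_two by simp
  then have "(t\<^sup>2 + t) * (x + 1) = 1"
    using x0 by (metis mult_cancel_left power_not_zero)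
  then have tz: "t\<^sup>2 + t = inverse (x + 1)"
    using x1 by (metis inverse_unique mult.commute inverse_inverse_eq)
  define z where "z = inverse (x + 1)"
  have z: "z * (x + 1) = 1" using x1 by (simp add: z_def)
  \<comment> \<open>Modulo 2, shifting the fifth cyclotomic polynomial by 1 gives X^4 + X^3 + 1. So
    x + 1 is a primitive fifth root of unity, and since the cyclotomic polynomial is palindromic,
    its inverse \<open>z\<close> is one too.\<close>
  have "(x + 1) ^ 4 + (x + 1) ^ 3 + (x + 1)\<^sup>2 + (x + 1) + 1
      = x ^ 4 + x ^ 3 - 1 + 2 * (2 * x ^ 3 + 5 * x\<^sup>2 + 5 * x + 3)"
    by algebra
  then have "(x + 1) ^ 4 + (x + 1) ^ 3 + (x + 1)\<^sup>2 + (x + 1) + 1 = 0"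
    unfolding char_two x by simp
  moreover have "z ^ 4 * ((x + 1) ^ 4 + (x + 1) ^ 3 + (x + 1)\<^sup>2 + (x + 1) + 1)
      = (z * (x + 1)) ^ 4 + z * (z * (x + 1)) ^ 3 + z\<^sup>2 * (z * (x + 1))\<^sup>2
        + z ^ 3 * (z * (x + 1)) + z ^ 4"
    by algebra
  ultimately have "z ^ 4 + z ^ 3 + z\<^sup>2 + z + 1 = 0"
    unfolding z by (simp add: add_ac)
  from fifth_root_not_artin_schreier[OF card this, of t] tz show False
    by (simp add: z_def)
qed

text \<open>The quadratic forces x^3 = a^3. If both elements satisfied the quartic, then also x^4 =
  a^4, hence x = a, which the quadratic rules out.\<close>

lemma cube_root_multiple_not_in_S:
  fixes x a :: 'a
  assumes a: "a ^ 4 + a ^ 3 = 1" and q: "x * (x + a) = a\<^sup>2"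
  shows "x ^ 4 + x ^ 3 \<noteq> 1"
proof
  assume x: "x ^ 4 + x ^ 3 = 1"
  have "x ^ 3 = a ^ 3 + 2 * (a\<^sup>2 * x - a ^ 3)" using q by algebra
  then have "x ^ 3 = a ^ 3" unfolding char_two by simp
  then have "a ^ 3 * (x + a) = 2 * a ^ 4" using x a by algebra
  then have "a ^ 3 * (x + a) = 0" by (simp add: char_two)
  moreover have "a \<noteq> 0" using a by auto
  ultimately have "x + a = 0" by simp
  with q \<open>a \<noteq> 0\<close> show False by simp
qed

text \<open>Here x^3 = 1, so x^4 + x^3 = x + 1, which is 1 only for x = 0.\<close>

lemma cube_root_of_unity_not_in_S:
  fixes x :: 'a
  assumes "x * (x + 1) = 1"
  shows "x ^ 4 + x ^ 3 \<noteq> 1"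
proof
  assume "x ^ 4 + x ^ 3 = 1"
  with assms have "x = 0" by algebra
  with assms show False by simp
qed

end

section \<open>Bijectivity and the exact differential uniformity\<close>

theorem theorem7:
  fixes n :: nat and S :: "'a::{finite,field} set" and f :: "'a \<Rightarrow> 'a"
  assumes "n > 0" and "4 dvd n" and "odd (n div 4)" and "gcd n 5 = 1"
    and "CARD('a) = 2 ^ n"
    and "S = {x. (inverse x) ^ 4 = inverse x + 1}"
    and "f = (\<lambda>x. inverse x + indicator S x)"
  shows "bij f \<and> differentially_4_uniform f"
proof
  define m where "m = n div 4"
  have n: "n = 4 * m" using assms(2) by (simp add: m_def)
  have card16: "CARD('a) = 16 ^ m"
    using assms(5) by (simp add: n power_mult)
  have "odd m" using assms(3) by (simp add: m_def)
  then have "m > 0" by (rule odd_pos)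
  have c2: "(2::'a) = 0"
    by (rule two_eq_zero_if_card_power_two[OF assms(5)])
  have S: "x \<in> S \<longleftrightarrow> x ^ 4 + x ^ 3 = 1" for x
    using inverse_quartic_iff[OF c2, of x] assms(6) by simp
  note self = char_two_add_self[OF c2]
  show "bij f"
  proof -
    define \<tau> where "\<tau> = (\<lambda>y::'a. if y ^ 4 = y + 1 then y + 1 else y)"
    have "f = \<tau> \<circ> inverse"
      by (auto simp: assms(6,7) \<tau>_def)
    moreover have "\<tau> \<circ> \<tau> = id"
      using char_two_fourth_power_add[OF c2] char_two_add_add[OF c2]
      by (auto simp: \<tau>_def fun_eq_iff)
    then have "bij \<tau>" using o_bij by blast
    moreover have "bij (inverse :: 'a \<Rightarrow> 'a)"
      by (rule o_bij[of inverse]) auto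
    ultimately show ?thesis by (simp add: bij_comp)
  qed
  have upper: "differential_count f a b \<le> 4" if "a \<noteq> 0" for a b
  proof -
    \<comment> \<open>Split by the indicator values at \<open>x\<close> and \<open>x + a\<close>: if
      they agree they cancel (\<open>A\<close>), otherwise they contribute 1, which moves to the
      right-hand side (\<open>B\<close>).\<close>
    define A where "A = {x. inverse (x + a) + inverse x = b \<and> (x + a \<in> S \<longleftrightarrow> x \<in> S)}"
    define B where "B = {x. inverse (x + a) + inverse x = b + 1 \<and> (x + a \<in> S \<longleftrightarrow> x \<notin> S)}"
    have sub: "{x. f (x + a) + f x = b} \<subseteq> A \<union> B"
    proof
      fix x assume "x \<in> {x. f (x + a) + f x = b}"
      then have *: "inverse (x + a) + inverse x + (indicator S (x + a) + indicator S x) = b"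
        by (simp add: assms(7) algebra_simps)
      show "x \<in> A \<union> B"
      proof (cases "x + a \<in> S \<longleftrightarrow> x \<in> S")
        case True
        with * have "x \<in> A"
          by (cases "x \<in> S") (auto simp: A_def c2)
        then show ?thesis by simp
      next
        case False
        with * have "inverse (x + a) + inverse x + 1 = b"
          by (cases "x \<in> S") auto
        with False have "x \<in> B"
          by (auto simp: B_def c2)
        then show ?thesis by simp
      qed
    qed
    have A2: "card A \<le> 2" if "b \<noteq> inverse a"
      by (rule order_trans[OF card_mono card_inverse_derivative_le_two[OF c2 \<open>a \<noteq> 0\<close> that]])
        (auto simp: A_def)
    have B2: "card B \<le> 2" if "b + 1 \<noteq> inverse a"
      by (rule order_trans[OF card_mono card_inverse_derivative_le_two[OF c2 \<open>a \<noteq> 0\<close> that]])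
        (auto simp: B_def)
    have "0 \<notin> S" by (simp add: S)
    define Q where "Q = {x. x * (x + a) = a\<^sup>2}"
    have Q2: "card Q \<le> 2"
      by (rule card_le_two_if_quadratic[OF c2]) (auto simp: Q_def)
    have "card (A \<union> B) \<le> 4"
    proof (cases "b = inverse a")
      case True
      have "x \<notin> B" for x
      proof
        assume x: "x \<in> B"
        have "x \<in> S \<or> x + a \<in> S" using x by (auto simp: B_def)
        then show False
        proof
          assume "x \<in> S"
          with inverse_derivative_neq_inverse_plus_one[OF c2 card16 \<open>odd m\<close> \<open>a \<noteq> 0\<close>] x True show False
            by (simp add: B_def S)
        next
          \<comment> \<open>The equation is symmetric under exchanging \<open>x\<close> and
            \<open>x + a\<close>.\<close>
          assume "x + a \<in> S"
          then have "inverse x + inverse (x + a) \<noteq> inverse a + 1"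
            using inverse_derivative_neq_inverse_plus_one[OF c2 card16 \<open>odd m\<close> \<open>a \<noteq> 0\<close>, of "x + a"]
            by (simp only: S char_two_add_add[OF c2] simp_thms)
          with x True show False
            by (simp add: B_def add.commute)
        qed
      qed
      then have "A \<union> B \<subseteq> {0, a} \<union> Q"
        using inverse_derivative_eq_inverse[OF c2 _ \<open>a \<noteq> 0\<close>] True
        by (auto simp: A_def Q_def)
      then have "card (A \<union> B) \<le> card ({0, a} \<union> Q)"
        by (intro card_mono) auto
      also have "\<dots> \<le> card {0, a} + card Q" by (rule card_Un_le)
      also have "\<dots> \<le> 4" using Q2 \<open>a \<noteq> 0\<close> by simp
      finally show ?thesis .
    next
      case False
      have "card B \<le> 2"
      proof (cases "b + 1 = inverse a")
        case True
        have B: "x \<in> {0, a} \<or> x \<in> Q" if "x \<in> B" for x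
          using that inverse_derivative_eq_inverse[OF c2 _ \<open>a \<noteq> 0\<close>] True
          by (auto simp: B_def Q_def)
        show ?thesis
        \<comment> \<open>Since 0 is outside \<open>S\<close>, the pair {0, a} meets the condition
          of \<open>B\<close> only if \<open>a\<close> is in \<open>S\<close>; in that case both
          elements of \<open>Q\<close> lie outside \<open>S\<close> and fail it.\<close>
        proof (cases "a \<in> S")
          case True
          have "x \<notin> B" if "x \<in> Q" for x
          proof -
            have "(x + a) * (x + a + a) = a\<^sup>2" "x * (x + a) = a\<^sup>2"
              using that by (simp_all add: Q_def char_two_add_add[OF c2] mult.commute)
            then have "x \<notin> S" "x + a \<notin> S"
              using cube_root_multiple_not_in_S[OF c2] True by (auto simp: S)
            then show ?thesis by (simp add: B_def)
          qed
          with B have "card B \<le> card {0, a}" by (intro card_mono) auto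
          then show ?thesis using \<open>a \<noteq> 0\<close> by simp
        next
          case False
          have "0 \<notin> B" "a \<notin> B"
            using False \<open>0 \<notin> S\<close> by (simp_all add: B_def self)
          with B have "B \<subseteq> Q" by blast
          then have "card B \<le> card Q" by (intro card_mono) auto
          with Q2 show ?thesis by simp
        qed
      qed (rule B2)
      with A2[OF False] show ?thesis
        using card_Un_le[of A B] by simp
    qed
    moreover have "card {x. f (x + a) + f x = b} \<le> card (A \<union> B)"
      by (rule card_mono[OF _ sub]) simp
    ultimately show ?thesis by (simp add: differential_count_def)
  qed
  \<comment> \<open>The bound is attained at a = b = 1: the points 0, 1, \<open>w\<close>,
    \<open>w + 1\<close> all avoid \<open>S\<close>, so \<open>f\<close> is plain inversion on
    them.\<close>
  have lower: "4 \<le> differential_count f 1 1"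
  proof -
    have "CARD('a) = 4 ^ (2 * m)" by (simp add: card16 power_mult)
    with \<open>m > 0\<close> obtain w :: 'a where w: "w\<^sup>2 + w + 1 = 0"
      using ex_primitive_cube_root by (metis mult_pos_pos zero_less_numeral)
    have "w * (w + 1) = 1 - 2" "(w + 1) * (w + 1 + 1) = 1 + 2 * w"
      using w by algebra+
    then have w1: "w * (w + 1) = 1" and w2: "(w + 1) * (w + 1 + 1) = 1"
      unfolding c2 by simp_all
    have notS: "0 \<notin> S" "1 \<notin> S" "w \<notin> S" "w + 1 \<notin> S"
      using cube_root_of_unity_not_in_S[OF c2] w1 w2 c2 by (auto simp: S)
    have "inverse (w + 1) + inverse w = 1"
      using inverse_derivative_eq_inverseI[OF c2, of w 1] w1 by simp
    then have "{0, 1, w, w + 1} \<subseteq> {x. f (x + 1) + f x = 1}"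
      using notS by (auto simp: assms(7) add.commute self c2)
    moreover have "card {0, 1, w, w + 1} = 4"
    proof -
      have "w \<noteq> 0" "w + 1 \<noteq> 0" "w \<noteq> 1" using w1 c2 by auto
      then show ?thesis by (auto simp: card_insert_if)
    qed
    ultimately show ?thesis
      unfolding differential_count_def by (metis card_mono finite)
  qed
  have "Max {differential_count f a b |a b. a \<noteq> 0} = 4"
  proof (rule Max_eqI)
    show "finite {differential_count f a b |a b. a \<noteq> 0}"
      by (rule finite_subset[of _ "{..4}"]) (use upper in auto)
    show "k \<le> 4" if "k \<in> {differential_count f a b |a b. a \<noteq> 0}" for k
      using that upper by auto
    have "differential_count f 1 1 = 4"
      using upper[of 1 1] lower by simp
    then show "4 \<in> {differential_count f a b |a b. a \<noteq> 0}"
      by (metis (mono_tags, lifting) mem_Collect_eq one_neq_zero)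
  qed
  then show "differentially_4_uniform f"
    by (simp add: differentially_4_uniform_def differential_uniformity_def)
qed

end
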